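(* Let $n,A,B,d\geq 1$ be integers, let $P_{ab}$ ($1\leq a\leq A$, $1\leq b\leq B$) be real polynomials in $n$ variables, each of degree at most $d$ in each variable, and suppose that $$E=\bigcup_{a=1}^A\bigcap_{b=1}^B\{x\in\mathbb{R}^n : P_{ab}(x)\leq 0\}$$ is nonempty and compact. (i) If $E\subset[0,1]^n$, then there exist an integer $N>n$ with $N\leq 1+AB+n(3+2\log_2 d)$ and an $N$-player binary game such that the projection of its set of Nash equilibria on its first $n$ coordinates (those of the first $n$ players) is equal to $E$. (ii) There exist an integer $N>n$ with $N\leq 1+AB+n(3+2\log_2 d)$ and an $N$-player binary game such that the projection of its set of Nash equilibrium payoffs on its first $n$ coordinates is equal to $E$.
   Context: A game is binary if it is a finite normal-form game in which each player has exactly two pure strategies; payoffs of pure strategy profiles are arbitrary real numbers. Nash equilibria are understood in mixed strategies, with payoffs extended to mixed strategy profiles by expectation. A mixed strategy of the $i$-th player is identified with the probability $x_i\in[0,1]$ that it assigns to the first of her two pure strategies, so the set of Nash equilibria of an $N$-player binary game is a subset of $[0,1]^N$. The set of Nash equilibrium payoffs is the set of vectors in $\mathbb{R}^N$ whose $i$-th coordinate is the expected payoff of player $i$, as the mixed profile ranges over all Nash equilibria. *)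

theory Defs
  imports "HOL-Analysis.Analysis" "HOL-Library.Poly_Mapping"
begin

text \<open>
  Points of \<open>\<real>\<^sup>n\<close> are the elements of \<open>topspace (Euclidean_space n)\<close>: functions
  \<open>nat \<Rightarrow> real\<close> that vanish at every index \<open>i \<ge> n\<close>. Coordinates, variables and players are
  numbered from \<open>0\<close>. The function \<open>trunc n\<close> is the projection to the first \<open>n\<close> coordinates.
\<close>

definition trunc :: "nat \<Rightarrow> (nat \<Rightarrow> real) \<Rightarrow> nat \<Rightarrow> real" where
  "trunc n x = (\<lambda>i. if i < n then x i else 0)"


text \<open>
  Multivariate polynomials are finitely supported maps from monomials to coefficients, where a
  monomial is the finitely supported map from variables to exponents.
\<close>

type_synonym real_mpoly = "(nat \<Rightarrow>\<^sub>0 nat) \<Rightarrow>\<^sub>0 real"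

definition mpoly_eval :: "real_mpoly \<Rightarrow> (nat \<Rightarrow> real) \<Rightarrow> real" where
  "mpoly_eval p x =
     (\<Sum>m\<in>Poly_Mapping.keys p. Poly_Mapping.lookup p m *
        (\<Prod>i\<in>Poly_Mapping.keys m. x i ^ Poly_Mapping.lookup m i))"

definition mpoly_vars :: "real_mpoly \<Rightarrow> nat set" where
  "mpoly_vars p = (\<Union>m\<in>Poly_Mapping.keys p. Poly_Mapping.keys m)"

text \<open>The zero polynomial has degree \<open>0\<close> here.\<close>

definition mpoly_degree :: "real_mpoly \<Rightarrow> nat \<Rightarrow> nat" where
  "mpoly_degree p i = Max (insert 0 ((\<lambda>m. Poly_Mapping.lookup m i) ` Poly_Mapping.keys p))"


text \<open>
  An \<open>N\<close>-player binary game has the players \<open>{..<N}\<close>, each with the pure strategy set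
  \<open>UNIV :: bool set\<close>, where \<open>True\<close> is the first pure strategy. It is given by the payoffs
  \<open>u i s\<close> of player \<open>i\<close> at the pure profiles \<open>s\<close>; only the values with \<open>i < N\<close> and
  \<open>s \<in> pure_profiles N\<close> matter.
\<close>

type_synonym binary_game = "nat \<Rightarrow> (nat \<Rightarrow> bool) \<Rightarrow> real"

definition pure_profiles :: "nat \<Rightarrow> (nat \<Rightarrow> bool) set" where
  "pure_profiles N = {..<N} \<rightarrow>\<^sub>E (UNIV :: bool set)"

definition mixed_profiles :: "nat \<Rightarrow> (nat \<Rightarrow> real) set" where
  "mixed_profiles N = {x \<in> topspace (Euclidean_space N). \<forall>i<N. x i \<in> {0..1}}"

definition expected_payoff :: "nat \<Rightarrow> binary_game \<Rightarrow> nat \<Rightarrow> (nat \<Rightarrow> real) \<Rightarrow> real" where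
  "expected_payoff N u i x =
     (\<Sum>s\<in>pure_profiles N. (\<Prod>j<N. if s j then x j else 1 - x j) * u i s)"

definition nash_equilibria :: "nat \<Rightarrow> binary_game \<Rightarrow> (nat \<Rightarrow> real) set" where
  "nash_equilibria N u =
     {x \<in> mixed_profiles N.
        \<forall>i<N. \<forall>y\<in>{0..1}. expected_payoff N u i (x(i := y)) \<le> expected_payoff N u i x}"

definition nash_payoffs :: "nat \<Rightarrow> binary_game \<Rightarrow> (nat \<Rightarrow> real) set" where
  "nash_payoffs N u =
     (\<lambda>x. trunc N (\<lambda>i. expected_payoff N u i x)) ` nash_equilibria N u"

end

theory Submission
  imports Defs
begin

text \<open>
  A player is indifferent exactly when the gain from her first strategy, an arbitrary
  multi-affine function of the other players' strategies, vanishes. Powers \<open>x\<^sub>i^(2^k)\<close> are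
  computed by pairs of players who play matching pennies against each other: in equilibrium both
  encode the same prescribed value, and having two copies allows one to square it at the next level.
  With the powers for \<open>2^k \<le> d\<close> every \<open>P\<^sub>a\<^sub>b(x)\<close> becomes multi-affine, hence can be the gain of a
  player \<open>(a, b)\<close>, who plays her first strategy if \<open>P\<^sub>a\<^sub>b(x) > 0\<close>. The product over \<open>a\<close> of the sums over
  \<open>b\<close> of these strategies can vanish if \<open>x \<in> E\<close> and must be positive otherwise. Giving player \<open>i\<close>
  this product times \<open>e\<^sub>i - x\<^sub>i\<close> as gain, for a fixed \<open>e \<in> E\<close>, forces \<open>x = e\<close> in the
  latter case, which is absurd. The gain of player \<open>i\<close> is thus \<open>0\<close> in equilibrium, so adding a
  copy of \<open>x\<^sub>i\<close> to her payoff makes her equilibrium payoff equal to \<open>x\<^sub>i\<close>.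
\<close>

section \<open>Multi-affine functions\<close>

definition indep_of :: "'p \<Rightarrow> (('p \<Rightarrow> real) \<Rightarrow> real) \<Rightarrow> bool" where
  "indep_of p F \<longleftrightarrow> (\<forall>v t. F (v(p := t)) = F v)"

text \<open>Interpolation between the values at 0 and 1 is the form that averaging over two pure
  strategies takes.\<close>

definition affine_in :: "'p \<Rightarrow> (('p \<Rightarrow> real) \<Rightarrow> real) \<Rightarrow> bool" where
  "affine_in p F \<longleftrightarrow> (\<forall>v t. F (v(p := t)) = (1 - t) * F (v(p := 0)) + t * F (v(p := 1)))"

lemma indep_imp_affine: "indep_of p F \<Longrightarrow> affine_in p F"
  by (simp add: indep_of_def affine_in_def algebra_simps)

lemma indep_of_const: "indep_of p (\<lambda>v. a)"
  by (simp add: indep_of_def)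

lemma indep_of_coord: "p \<noteq> q \<Longrightarrow> indep_of p (\<lambda>v. v q)"
  by (simp add: indep_of_def)

lemma indep_of_diff: "indep_of p F \<Longrightarrow> indep_of p G \<Longrightarrow> indep_of p (\<lambda>v. F v - G v)"
  by (simp add: indep_of_def)

lemma indep_of_mult: "indep_of p F \<Longrightarrow> indep_of p G \<Longrightarrow> indep_of p (\<lambda>v. F v * G v)"
  by (simp add: indep_of_def)

lemma indep_of_sum: "(\<And>i. i \<in> I \<Longrightarrow> indep_of p (F i)) \<Longrightarrow> indep_of p (\<lambda>v. \<Sum>i\<in>I. F i v)"
  by (simp add: indep_of_def)

lemma indep_of_prod: "(\<And>i. i \<in> I \<Longrightarrow> indep_of p (F i)) \<Longrightarrow> indep_of p (\<lambda>v. \<Prod>i\<in>I. F i v)"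
  by (simp add: indep_of_def)

lemma affine_in_coord: "affine_in p (\<lambda>v. v q)"
  by (simp add: affine_in_def algebra_simps)

lemma affine_in_const: "affine_in p (\<lambda>v. a)"
  by (simp add: indep_of_const indep_imp_affine)

lemma affine_in_add: "affine_in p F \<Longrightarrow> affine_in p G \<Longrightarrow> affine_in p (\<lambda>v. F v + G v)"
  unfolding affine_in_def
proof (intro allI)
  fix v t
  assume "\<forall>v t. F (v(p := t)) = (1 - t) * F (v(p := 0)) + t * F (v(p := 1))"
    and "\<forall>v t. G (v(p := t)) = (1 - t) * G (v(p := 0)) + t * G (v(p := 1))"
  then have "F (v(p := t)) + G (v(p := t)) =
      ((1 - t) * F (v(p := 0)) + t * F (v(p := 1))) + ((1 - t) * G (v(p := 0)) + t * G (v(p := 1)))"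
    by metis
  then show "F (v(p := t)) + G (v(p := t)) =
      (1 - t) * (F (v(p := 0)) + G (v(p := 0))) + t * (F (v(p := 1)) + G (v(p := 1)))"
    by (simp add: algebra_simps)
qed

lemma affine_in_mult_left:
  assumes "indep_of p F" "affine_in p G"
  shows "affine_in p (\<lambda>v. F v * G v)"
  unfolding affine_in_def
proof (intro allI)
  fix v t
  have "F (v(p := s)) = F v" for s
    using assms(1) by (simp add: indep_of_def)
  moreover have "G (v(p := t)) = (1 - t) * G (v(p := 0)) + t * G (v(p := 1))"
    using assms(2) unfolding affine_in_def by blast
  ultimately have "F (v(p := t)) * G (v(p := t)) =
      F v * ((1 - t) * G (v(p := 0)) + t * G (v(p := 1)))" and "F (v(p := s)) = F v" for s
    by simp_all
  then show "F (v(p := t)) * G (v(p := t)) =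
      (1 - t) * (F (v(p := 0)) * G (v(p := 0))) + t * (F (v(p := 1)) * G (v(p := 1)))"
    by (simp add: algebra_simps)
qed

lemma affine_in_mult_right:
  assumes "affine_in p F" "indep_of p G"
  shows "affine_in p (\<lambda>v. F v * G v)"
  using affine_in_mult_left[OF assms(2,1)] by (simp add: mult.commute)

lemma affine_in_diff:
  assumes "affine_in p F" "affine_in p G"
  shows "affine_in p (\<lambda>v. F v - G v)"
  using affine_in_add[OF assms(1) affine_in_mult_left[OF indep_of_const[of p "-1"] assms(2)]]
  by simp

lemma affine_in_sum:
  "(\<And>i. i \<in> I \<Longrightarrow> affine_in p (F i)) \<Longrightarrow> affine_in p (\<lambda>v. \<Sum>i\<in>I. F i v)"
  by (induction I rule: infinite_finite_induct) (simp_all add: affine_in_const affine_in_add)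

text \<open>Only the factor at \<open>i0\<close> may depend on \<open>p\<close>; it is split off
  from an independent product. If \<open>i0\<close> lies outside \<open>I\<close>, the whole product
  is independent of \<open>p\<close>.\<close>

lemma affine_in_prod:
  assumes "\<And>i. i \<in> I \<Longrightarrow> affine_in p (F i)"
    and "\<And>i. i \<in> I \<Longrightarrow> i \<noteq> i0 \<Longrightarrow> indep_of p (F i)"
  shows "affine_in p (\<lambda>v. \<Prod>i\<in>I. F i v)"
proof (cases "finite I \<and> i0 \<in> I")
  case True
  then have "(\<Prod>i\<in>I. F i v) = F i0 v * (\<Prod>i\<in>I - {i0}. F i v)" for v
    by (auto intro: prod.remove)
  moreover have "affine_in p (\<lambda>v. F i0 v * (\<Prod>i\<in>I - {i0}. F i v))"
    using assms True by (intro affine_in_mult_right indep_of_prod) auto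
  ultimately show ?thesis by simp
next
  case False
  then show ?thesis
  proof (cases "finite I")
    case True
    with False assms show ?thesis
      by (intro indep_imp_affine indep_of_prod) auto
  qed (simp add: affine_in_const)
qed


section \<open>Binary games with multi-affine payoffs\<close>

text \<open>Averaging over the last player is interpolation in her coordinate, hence the induction.
  Coordinates from \<open>N\<close> on keep their values in \<open>x\<close>, so that the hypothesis
  applies to \<open>x(N := t)\<close>.\<close>

lemma sum_pure_profiles_affine:
  assumes "\<And>j. j < N \<Longrightarrow> affine_in j f"
  shows "(\<Sum>s\<in>pure_profiles N. (\<Prod>j<N. if s j then x j else 1 - x j) *
           f (\<lambda>j. if j < N then of_bool (s j) else x j)) = f x"
  using assms
proof (induction N arbitrary: x)
  case 0
  then show ?case by (simp add: pure_profiles_def)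
next
  case (Suc N)
  let ?g = "\<lambda>s x j. if j < N then of_bool (s j) else x j"
  let ?w = "\<lambda>s. \<Prod>j<N. if s j then x j else 1 - x j"
  let ?h = "\<lambda>s. (\<Prod>j<Suc N. if s j then x j else 1 - x j) *
     f (\<lambda>j. if j < Suc N then of_bool (s j) else x j)"
  have eq: "pure_profiles (Suc N) = (\<lambda>(b, s). s(N := b)) ` (UNIV \<times> pure_profiles N)"
    by (simp add: pure_profiles_def lessThan_Suc PiE_insert_eq)
  have inj: "inj_on (\<lambda>(b, s). s(N := b)) (UNIV \<times> pure_profiles N)"
    unfolding pure_profiles_def by (rule inj_combinator) simp
  have w: "(\<Prod>j<N. if (s(N := b)) j then x j else 1 - x j) = ?w s" for b :: bool and s
    by (rule prod.cong) auto
  have g: "(\<lambda>j. if j < Suc N then of_bool ((s(N := b)) j) else x j) = ?g s (x(N := of_bool b))"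
    for b s by (auto simp: fun_eq_iff less_Suc_eq)
  have h: "?h (s(N := b)) = (if b then x N else 1 - x N) * (?w s * f (?g s (x(N := of_bool b))))"
    for b s
    by (simp only: g prod.lessThan_Suc w) simp
  have IH: "(\<Sum>s\<in>pure_profiles N. ?w s * f (?g s (x(N := t)))) = f (x(N := t))" for t
  proof -
    have "(\<Prod>j<N. if s j then (x(N := t)) j else 1 - (x(N := t)) j) = ?w s" for s
      by (rule prod.cong) auto
    with Suc.IH[of "x(N := t)"] Suc.prems show ?thesis by (simp add: fun_upd_def)
  qed
  have "sum ?h (pure_profiles (Suc N)) = (\<Sum>(b, s)\<in>UNIV \<times> pure_profiles N. ?h (s(N := b)))"
    unfolding eq by (subst sum.reindex[OF inj]) (simp add: case_prod_unfold)
  also have "\<dots> = (\<Sum>b\<in>UNIV. (if b then x N else 1 - x N) * f (x(N := of_bool b)))"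
    by (simp only: h sum.cartesian_product[symmetric] sum_distrib_left[symmetric] IH)
  also have "\<dots> = (1 - x N) * f (x(N := 0)) + x N * f (x(N := 1))"
    by (simp add: UNIV_bool)
  also have "\<dots> = f (x(N := x N))"
    using Suc.prems[of N] unfolding affine_in_def by (metis lessI)
  finally show ?case by simp
qed

text \<open>\<open>D i\<close> is the gain from the first strategy. If neither function depends on
  coordinate \<open>i\<close>, then \<open>C i\<close> shifts the payoff without affecting
  incentives.\<close>

definition affine_game ::
  "nat \<Rightarrow> (nat \<Rightarrow> (nat \<Rightarrow> real) \<Rightarrow> real) \<Rightarrow> (nat \<Rightarrow> (nat \<Rightarrow> real) \<Rightarrow> real) \<Rightarrow> binary_game"
  where "affine_game N D C i s =
    (let x = (\<lambda>j. if j < N then of_bool (s j) else 0) in x i * D i x + C i x)"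

lemma mixed_profiles_iff:
  "x \<in> mixed_profiles N \<longleftrightarrow> (\<forall>i\<ge>N. x i = 0) \<and> (\<forall>i<N. 0 \<le> x i \<and> x i \<le> 1)"
  by (auto simp: mixed_profiles_def topspace_Euclidean_space)

context
  fixes N :: nat and D C :: "nat \<Rightarrow> (nat \<Rightarrow> real) \<Rightarrow> real"
  assumes affine: "\<And>i j. i < N \<Longrightarrow> j < N \<Longrightarrow> affine_in j (D i) \<and> affine_in j (C i)"
    and indep: "\<And>i. i < N \<Longrightarrow> indep_of i (D i) \<and> indep_of i (C i)"
begin

lemma expected_payoff_affine_game:
  assumes "i < N" "x \<in> mixed_profiles N"
  shows "expected_payoff N (affine_game N D C) i x = x i * D i x + C i x"
proof -
  have "affine_in j (\<lambda>x. x i * D i x + C i x)" if "j < N" for j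
  proof (cases "j = i")
    case True
    with indep[OF assms(1)] show ?thesis
      by (intro affine_in_add affine_in_mult_right affine_in_coord) (auto intro: indep_imp_affine)
  next
    case False
    with affine[OF assms(1) that] show ?thesis
      by (intro affine_in_add affine_in_mult_left indep_of_coord) auto
  qed
  from sum_pure_profiles_affine[OF this, of N x]
  have "(\<Sum>s\<in>pure_profiles N. (\<Prod>j<N. if s j then x j else 1 - x j) *
      (let x' = (\<lambda>j. if j < N then of_bool (s j) else x j) in x' i * D i x' + C i x'))
    = x i * D i x + C i x"
    by (simp add: Let_def)
  \<comment> \<open>Mixed profiles vanish from index \<open>N\<close> on, in agreement with the
    default 0 in \<open>affine_game\<close>.\<close>
  moreover have "(\<lambda>j. if j < N then of_bool (s j) else x j) =
      (\<lambda>j. if j < N then of_bool (s j) else 0)" for s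
    using assms(2) by (auto simp: mixed_profiles_iff fun_eq_iff)
  ultimately show ?thesis
    by (simp only: expected_payoff_def affine_game_def)
qed

text \<open>The payoff of player \<open>i\<close> is affine in her own strategy with slope
  \<open>D i x\<close>, so the sign of the slope decides which strategies are best.\<close>

lemma nash_affine_game_iff:
  "x \<in> nash_equilibria N (affine_game N D C) \<longleftrightarrow>
     x \<in> mixed_profiles N \<and> (\<forall>i<N. (D i x > 0 \<longrightarrow> x i = 1) \<and> (D i x < 0 \<longrightarrow> x i = 0))"
proof (cases "x \<in> mixed_profiles N")
  case True
  have "(\<forall>y\<in>{0..1}. expected_payoff N (affine_game N D C) i (x(i := y))
            \<le> expected_payoff N (affine_game N D C) i x) \<longleftrightarrow>
        (D i x > 0 \<longrightarrow> x i = 1) \<and> (D i x < 0 \<longrightarrow> x i = 0)" (is "?L \<longleftrightarrow> ?R") if i: "i < N" for i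
  proof -
    have "expected_payoff N (affine_game N D C) i (x(i := y)) = y * D i x + C i x"
      if "y \<in> {0..1}" for y
    proof -
      have "x(i := y) \<in> mixed_profiles N"
        using True i that by (auto simp: mixed_profiles_iff)
      with expected_payoff_affine_game[OF i this] indep[OF i] show ?thesis
        by (simp add: indep_of_def)
    qed
    then have L: "?L \<longleftrightarrow> (\<forall>y\<in>{0..1}. y * D i x \<le> x i * D i x)"
      by (simp add: expected_payoff_affine_game[OF i True])
    have x: "0 \<le> x i" "x i \<le> 1" using True i by (auto simp: mixed_profiles_iff)
    show ?thesis
    proof
      assume ?L
      then have best: "y * D i x \<le> x i * D i x" if "y \<in> {0..1}" for y
        using L that by blast
      from best[of 1] best[of 0] x show ?R
        by (auto simp: mult_le_cancel_right zero_le_mult_iff)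
    next
      assume R: ?R
      consider "D i x > 0" | "D i x < 0" | "D i x = 0" by linarith
      then show ?L unfolding L
      proof cases
        case 1 with R show "\<forall>y\<in>{0..1}. y * D i x \<le> x i * D i x" by simp
      next
        case 2 with R show "\<forall>y\<in>{0..1}. y * D i x \<le> x i * D i x"
          by (simp add: mult_nonneg_nonpos)
      qed simp
    qed
  qed
  with True show ?thesis by (simp add: nash_equilibria_def)
qed (simp add: nash_equilibria_def)

end


section \<open>Polynomials through repeated squaring\<close>

text \<open>Each \<open>x ^ (2 ^ k)\<close> occurs at most once, so the product is multi-affine once
  these powers become separate variables. The induction passes to \<open>x ^ 2\<close> and
  \<open>m div 2\<close>.\<close>

lemma power_eq_prod_binary_digits:
  fixes x :: "'a::comm_monoid_mult"
  assumes "m < 2 ^ K"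
  shows "x ^ m = (\<Prod>k<K. if odd (m div 2 ^ k) then x ^ (2 ^ k) else 1)"
  using assms
proof (induction K arbitrary: x m)
  case (Suc K)
  have IH: "(x ^ 2) ^ (m div 2) =
      (\<Prod>k<K. if odd (m div 2 div 2 ^ k) then (x ^ 2) ^ (2 ^ k) else 1)"
    using Suc.prems by (intro Suc.IH) auto
  have sq: "(x ^ 2) ^ (2 ^ k) = x ^ (2 ^ Suc k)" for k
    by (simp add: power_mult)
  have "x ^ m = x ^ (m mod 2 + 2 * (m div 2))" by simp
  also have "\<dots> = x ^ (m mod 2) * (x ^ 2) ^ (m div 2)"
    by (simp only: power_add power_mult)
  also have "\<dots> = (if odd m then x else 1) *
      (\<Prod>k<K. if odd (m div 2 ^ Suc k) then x ^ (2 ^ Suc k) else 1)"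
    unfolding IH sq by (simp add: odd_iff_mod_2_eq_one div_mult2_eq)
  also have "\<dots> = (\<Prod>k<Suc K. if odd (m div 2 ^ k) then x ^ (2 ^ k) else 1)"
    by (subst prod.lessThan_Suc_shift) simp
  finally show ?case .
qed simp

lemma lookup_le_mpoly_degree:
  assumes "m \<in> Poly_Mapping.keys p"
  shows "Poly_Mapping.lookup m i \<le> mpoly_degree p i"
  unfolding mpoly_degree_def using assms by (intro Max_ge) auto

text \<open>A matching-pennies pair: \<open>g\<close> and \<open>h\<close> stand for rescaled mixed strategies of two players. The
  prescribed value stays away from the extreme strategies, so neither player can be stuck
  at a pure strategy.\<close>

lemma matching_pair_forced:
  fixes y z f \<gamma> :: real
  defines "g \<equiv> \<gamma> * (y - 1/2)" and "h \<equiv> \<gamma> * (z - 1/2)"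
  assumes "\<gamma> > 0" "\<bar>f\<bar> \<le> \<gamma> / 4"
    and "g - f > 0 \<longrightarrow> z = 1" "g - f < 0 \<longrightarrow> z = 0"
    and "f - h > 0 \<longrightarrow> y = 1" "f - h < 0 \<longrightarrow> y = 0"
  shows "g = f" "h = f"
proof -
  have "z = 1 \<Longrightarrow> h = \<gamma> / 2" "z = 0 \<Longrightarrow> h = - (\<gamma> / 2)" "y = 1 \<Longrightarrow> g = \<gamma> / 2" "y = 0 \<Longrightarrow> g = - (\<gamma> / 2)"
    by (simp_all add: g_def h_def)
  note pure = this
  have f: "f < \<gamma> / 2" "- (\<gamma> / 2) < f" using assms(3,4) by (simp_all add: abs_le_iff)
  \<comment> \<open>Too large an \<open>h\<close> drives \<open>g\<close> to its minimum, which in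
    turn drives \<open>h\<close> below \<open>f\<close>.\<close>
  have "\<not> h > f"
  proof
    assume "h > f"
    with assms(8) have "y = 0" by simp
    then have "g < f" using pure(4) f by simp
    with assms(6) have "z = 0" by simp
    then show False using pure(2) f \<open>h > f\<close> by simp
  qed
  moreover have "\<not> h < f"
  proof
    assume "h < f"
    with assms(7) have "y = 1" by simp
    then have "g > f" using pure(3) f by simp
    with assms(5) have "z = 1" by simp
    then show False using pure(1) f \<open>h < f\<close> by simp
  qed
  ultimately show "h = f" by simp
  then have "z \<noteq> 1" "z \<noteq> 0" using pure(1,2) f by auto
  with assms(5,6) show "g = f" by linarith
qed


section \<open>The game\<close>

text \<open>\<open>Z a b\<close> tests the sign of \<open>P a b\<close>. With named players,
  dependence on a strategy is a matter of distinct constructors; numbers are assigned at the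
  end.\<close>

datatype player = X nat | Y nat nat bool | Z nat nat

definition semialgebraic :: "nat \<Rightarrow> nat \<Rightarrow> nat \<Rightarrow> (nat \<Rightarrow> nat \<Rightarrow> real_mpoly) \<Rightarrow> (nat \<Rightarrow> real) set" where
  "semialgebraic n A B P =
     (\<Union>a\<in>{1..A}. \<Inter>b\<in>{1..B}. {x \<in> topspace (Euclidean_space n). mpoly_eval (P a b) x \<le> 0})"

text \<open>Player \<open>X i\<close> represents the coordinate \<open>c + r * v (X i)\<close>, and \<open>dec i k s\<close> reads off the
  strategy of player \<open>Y i k s\<close> a copy (one for each \<open>s\<close>) of the \<open>2^k\<close>-th power of this coordinate.\<close>

locale semialgebraic_game =
  fixes n A B d L :: nat
    and P :: "nat \<Rightarrow> nat \<Rightarrow> real_mpoly"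
    and e :: "nat \<Rightarrow> real" and c r M :: real
  assumes vars: "\<And>a b. a \<in> {1..A} \<Longrightarrow> b \<in> {1..B} \<Longrightarrow> mpoly_vars (P a b) \<subseteq> {..<n}"
    and degree: "\<And>a b i. a \<in> {1..A} \<Longrightarrow> b \<in> {1..B} \<Longrightarrow> i < n \<Longrightarrow> mpoly_degree (P a b) i \<le> d"
    and d_less: "d < 2 ^ Suc L"
    and e_in: "e \<in> semialgebraic n A B P"
    and box: "\<And>x i. x \<in> semialgebraic n A B P \<Longrightarrow> i < n \<Longrightarrow> c \<le> x i \<and> x i \<le> c + r"
    and B_pos: "B \<ge> 1" and r_pos: "r > 0" and M_pos: "M > 0"
    and bound: "\<And>t. 0 \<le> t \<Longrightarrow> t \<le> 1 \<Longrightarrow> \<bar>c + r * t\<bar> \<le> M"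
begin

abbreviation "E \<equiv> semialgebraic n A B P"

definition players :: "player set" where
  "players = X ` {..<n} \<union> (\<lambda>(i, k, s). Y i k s) ` ({..<n} \<times> {..L} \<times> UNIV)
     \<union> (\<lambda>(a, b). Z a b) ` ({1..A} \<times> {1..B})"

text \<open>The range reaches to twice the bound \<open>M ^ 2 ^ k\<close> on the encoded power, so
  the encoding strategy lies between 1/4 and 3/4.\<close>

definition dec :: "nat \<Rightarrow> nat \<Rightarrow> bool \<Rightarrow> (player \<Rightarrow> real) \<Rightarrow> real" where
  "dec i k s v = 4 * M ^ 2 ^ k * (v (Y i k s) - 1/2)"

text \<open>Squaring multiplies the copies of two different players, since the square of a single
  strategy is not affine in it.\<close>

definition target :: "nat \<Rightarrow> nat \<Rightarrow> (player \<Rightarrow> real) \<Rightarrow> real" where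
  "target i k v =
     (case k of 0 \<Rightarrow> c + r * v (X i) | Suc l \<Rightarrow> dec i l True v * dec i l False v)"

definition eval_dec :: "real_mpoly \<Rightarrow> (player \<Rightarrow> real) \<Rightarrow> real" where
  "eval_dec p v = (\<Sum>m\<in>Poly_Mapping.keys p. Poly_Mapping.lookup p m *
     (\<Prod>i\<in>Poly_Mapping.keys m. \<Prod>k<Suc L.
        if odd (Poly_Mapping.lookup m i div 2 ^ k) then dec i k False v else 1))"

text \<open>For nonnegative strategies this vanishes iff some \<open>a\<close> has
  \<open>v (Z a b) = 0\<close> for all \<open>b\<close>, mirroring the union of
  intersections.\<close>

definition violation :: "(player \<Rightarrow> real) \<Rightarrow> real" where
  "violation v = (\<Prod>a\<in>{1..A}. \<Sum>b\<in>{1..B}. v (Z a b))"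

text \<open>A gain must ignore its owner's strategy, so \<open>X i\<close> compares
  \<open>e i\<close> with a copy of her coordinate. \<open>Y i k False\<close> and
  \<open>Y i k True\<close> act as \<open>y\<close> and \<open>z\<close> in
  \<open>matching_pair_forced\<close>.\<close>

fun gain :: "player \<Rightarrow> (player \<Rightarrow> real) \<Rightarrow> real" where
  "gain (X i) = (\<lambda>v. violation v * (e i - dec i 0 False v))"
| "gain (Y i k True) = (\<lambda>v. dec i k False v - target i k v)"
| "gain (Y i k False) = (\<lambda>v. target i k v - dec i k True v)"
| "gain (Z a b) = (\<lambda>v. eval_dec (P a b) v)"

fun bonus :: "player \<Rightarrow> (player \<Rightarrow> real) \<Rightarrow> real" where
  "bonus (X i) = (\<lambda>v. dec i 0 False v)"
| "bonus _ = (\<lambda>v. 0)"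

section \<open>Multi-affinity and independence of the gains\<close>

lemma dec_indep: "p \<noteq> Y i k s \<Longrightarrow> indep_of p (dec i k s)"
  by (simp add: indep_of_def dec_def)

lemma dec_affine: "affine_in p (dec i k s)"
  unfolding dec_def
  by (intro affine_in_mult_left affine_in_diff indep_of_const affine_in_const affine_in_coord)

lemma target_affine: "affine_in p (target i k)"
proof (cases k)
  case 0
  then show ?thesis unfolding target_def
    by (simp add: affine_in_add affine_in_mult_left indep_of_const affine_in_const affine_in_coord)
next
  case (Suc l)
  have "affine_in p (\<lambda>v. dec i l True v * dec i l False v)"
  proof (cases "p = Y i l True")
    case True
    then show ?thesis by (intro affine_in_mult_right dec_affine dec_indep) auto
  next
    case False
    then show ?thesis by (intro affine_in_mult_left dec_affine dec_indep) auto
  qed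
  then show ?thesis unfolding target_def using Suc by simp
qed

lemma target_indep: "indep_of (Y i k s) (target i k)"
  unfolding target_def indep_of_def by (auto simp: dec_def split: nat.split)

lemma eval_dec_affine: "affine_in p (eval_dec q)"
proof -
  let ?F = "\<lambda>m i k v. if odd (Poly_Mapping.lookup m i div 2 ^ k) then dec i k False v else 1"
  have aff: "affine_in p (?F m i k)" for m :: "nat \<Rightarrow>\<^sub>0 nat" and i k
    by (cases "odd (Poly_Mapping.lookup m i div 2 ^ k)") (simp_all add: dec_affine affine_in_const)
  have ind: "indep_of p (?F m i k)" if "p \<noteq> Y i k False" for m :: "nat \<Rightarrow>\<^sub>0 nat" and i k
    using that
    by (cases "odd (Poly_Mapping.lookup m i div 2 ^ k)") (simp_all add: dec_indep indep_of_const)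
  \<comment> \<open>If \<open>p\<close> is a \<open>False\<close> copy, its indices locate the only
    factor that depends on it; otherwise any \<open>i0\<close> and \<open>k0\<close> will
    do.\<close>
  obtain i0 k0 where pi: "\<And>i k. p = Y i k False \<Longrightarrow> i = i0 \<and> k = k0"
    by (cases p) auto
  show ?thesis unfolding eval_dec_def
    apply (intro affine_in_sum affine_in_mult_left indep_of_const)
    apply (rule affine_in_prod[where ?i0.0 = i0])
     apply (rule affine_in_prod[where ?i0.0 = k0])
      apply (rule aff)
     apply (rule ind, use pi in blast)
    apply (rule indep_of_prod, rule ind, use pi in blast)
    done
qed

lemma eval_dec_indep: "indep_of (Z a b) (eval_dec q)" "indep_of (X a) (eval_dec q)"
  by (simp_all add: eval_dec_def indep_of_def dec_def cong: if_cong)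

lemma violation_affine: "affine_in p violation"
proof -
  obtain a0 where "\<And>a b. p = Z a b \<Longrightarrow> a = a0" by (cases p) auto
  then show ?thesis unfolding violation_def
    by (intro affine_in_prod[where ?i0.0 = a0] affine_in_sum indep_of_sum affine_in_coord
        indep_of_coord) auto
qed

lemma violation_indep: "(\<And>a b. p \<noteq> Z a b) \<Longrightarrow> indep_of p violation"
  unfolding violation_def by (intro indep_of_prod indep_of_sum indep_of_coord) auto

text \<open>The delicate case is \<open>X i\<close>: \<open>violation\<close> involves only
  \<open>Z\<close> players and the other factor only a \<open>Y\<close> player, so nobody enters
  both.\<close>

lemma gain_affine: "affine_in p (gain q)"
proof (cases q rule: gain.cases)
  case (1 i)
  have "affine_in p (\<lambda>v. violation v * (e i - dec i 0 False v))"
  proof (cases p)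
    case (Z a b)
    then show ?thesis
      by (intro affine_in_mult_right violation_affine indep_of_diff indep_of_const dec_indep) auto
  next
    case (X j)
    then show ?thesis
      by (intro affine_in_mult_left affine_in_diff violation_indep affine_in_const dec_affine) auto
  next
    case (Y j k s)
    then show ?thesis
      by (intro affine_in_mult_left affine_in_diff violation_indep affine_in_const dec_affine) auto
  qed
  with 1 show ?thesis by simp
qed (auto simp: affine_in_diff dec_affine target_affine eval_dec_affine)

lemma gain_indep: "indep_of p (gain p)"
proof (cases p rule: gain.cases)
  case (1 i)
  then show ?thesis
    by (auto intro!: indep_of_mult indep_of_diff violation_indep indep_of_const dec_indep)
qed (auto intro!: indep_of_diff dec_indep target_indep eval_dec_indep)

lemma bonus_affine: "affine_in p (bonus q)"
  by (cases q) (simp_all add: affine_in_const dec_affine)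

lemma bonus_indep: "indep_of p (bonus p)"
  by (cases p) (simp_all add: indep_of_const dec_indep)

section \<open>From equilibria to points of \<open>E\<close>\<close>

definition equilibrium :: "(player \<Rightarrow> real) \<Rightarrow> bool" where
  "equilibrium v \<longleftrightarrow> (\<forall>p\<in>players. 0 \<le> v p \<and> v p \<le> 1 \<and>
     (gain p v > 0 \<longrightarrow> v p = 1) \<and> (gain p v < 0 \<longrightarrow> v p = 0))"

definition point :: "(player \<Rightarrow> real) \<Rightarrow> nat \<Rightarrow> real" where
  "point v i = (if i < n then c + r * v (X i) else 0)"

lemma players_simps [simp]:
  "X i \<in> players \<longleftrightarrow> i < n"
  "Y i k s \<in> players \<longleftrightarrow> i < n \<and> k \<le> L"
  "Z a b \<in> players \<longleftrightarrow> a \<in> {1..A} \<and> b \<in> {1..B}"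
  by (auto simp: players_def image_iff)

text \<open>The degree bound keeps exponents below \<open>2 ^ Suc L\<close>, so the binary digits 0
  to \<open>L\<close> represent them.\<close>

lemma eval_dec_eq:
  assumes dec: "\<And>i k. i < n \<Longrightarrow> k \<le> L \<Longrightarrow> dec i k False v = x i ^ 2 ^ k"
    and ab: "a \<in> {1..A}" "b \<in> {1..B}"
  shows "eval_dec (P a b) v = mpoly_eval (P a b) x"
  unfolding eval_dec_def mpoly_eval_def
proof (intro sum.cong prod.cong refl arg_cong2[where f = "(*)"])
  fix m i
  assume m: "m \<in> Poly_Mapping.keys (P a b)" and i: "i \<in> Poly_Mapping.keys m"
  have "i < n" using vars[OF ab] m i by (auto simp: mpoly_vars_def)
  then have "Poly_Mapping.lookup m i < 2 ^ Suc L"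
    using lookup_le_mpoly_degree[OF m, of i] degree[OF ab, of i] d_less by linarith
  from power_eq_prod_binary_digits[OF this, of "x i"] dec \<open>i < n\<close>
  show "(\<Prod>k<Suc L. if odd (Poly_Mapping.lookup m i div 2 ^ k) then dec i k False v else 1)
      = x i ^ Poly_Mapping.lookup m i"
    by (auto intro!: prod.cong)
qed

lemma abs_point_le:
  assumes "equilibrium v" "i < n"
  shows "\<bar>point v i\<bar> \<le> M"
  using assms bound by (simp add: point_def equilibrium_def)

lemma dec_eq_target_power:
  assumes eq: "equilibrium v" and i: "i < n" and k: "k \<le> L"
    and t: "target i k v = point v i ^ 2 ^ k"
  shows "dec i k s v = point v i ^ 2 ^ k"
proof -
  have "\<bar>point v i\<bar> ^ 2 ^ k \<le> M ^ 2 ^ k"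
    by (rule power_mono) (simp_all add: abs_point_le[OF eq i])
  \<comment> \<open>The scale of \<open>dec\<close> is four times the bound on the target, as
    \<open>matching_pair_forced\<close> demands.\<close>
  then have f: "\<bar>point v i ^ 2 ^ k\<bar> \<le> 4 * M ^ 2 ^ k / 4"
    by (simp add: power_abs)
  have best: "(gain (Y i k s) v > 0 \<longrightarrow> v (Y i k s) = 1) \<and> (gain (Y i k s) v < 0 \<longrightarrow> v (Y i k s) = 0)"
    for s using eq i k unfolding equilibrium_def by simp
  have pos: "4 * M ^ 2 ^ k > 0" using M_pos by simp
  note best[of True, unfolded gain.simps t] best[of False, unfolded gain.simps t]
  then have "dec i k False v = point v i ^ 2 ^ k" "dec i k True v = point v i ^ 2 ^ k"
    unfolding dec_def by (blast intro: matching_pair_forced[OF pos f])+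
  then show ?thesis by (cases s) auto
qed

text \<open>The target at level \<open>Suc k\<close> is the product of both copies at level
  \<open>k\<close>, hence the induction for all \<open>s\<close>.\<close>

lemma dec_equilibrium:
  assumes "equilibrium v" "i < n" "k \<le> L"
  shows "dec i k s v = point v i ^ 2 ^ k"
  using assms(3)
proof (induction k arbitrary: s)
  case (0 s)
  with assms(2) show ?case
    by (intro dec_eq_target_power[OF assms(1)]) (simp_all add: target_def point_def)
next
  case (Suc k s)
  then have "target i (Suc k) v = point v i ^ 2 ^ k * point v i ^ 2 ^ k"
    by (simp add: target_def)
  also have "\<dots> = point v i ^ 2 ^ Suc k"
    by (simp add: mult_2 power_add)
  finally show ?case using Suc.prems assms(2)
    by (intro dec_eq_target_power[OF assms(1)]) simp_all
qed

lemma violation_nonneg: "equilibrium v \<Longrightarrow> violation v \<ge> 0"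
  unfolding violation_def equilibrium_def by (intro prod_nonneg sum_nonneg) auto

text \<open>A positive gain would push the coordinate to the upper end \<open>c + r\<close> of the
  box, yet also require it to be less than \<open>e i\<close>, which lies in the box. A negative
  gain is symmetric.\<close>

lemma gain_X_eq_0:
  assumes "equilibrium v" "i < n"
  shows "gain (X i) v = 0"
proof -
  have gain: "gain (X i) v = violation v * (e i - point v i)"
    using dec_equilibrium[OF assms, of 0] by simp
  have e: "c \<le> e i" "e i \<le> c + r" using box[OF e_in assms(2)] by auto
  have best: "gain (X i) v > 0 \<longrightarrow> v (X i) = 1" "gain (X i) v < 0 \<longrightarrow> v (X i) = 0"
    using assms unfolding equilibrium_def by simp_all
  show ?thesis
  proof (rule ccontr)
    assume "gain (X i) v \<noteq> 0"
    then consider "gain (X i) v > 0" | "gain (X i) v < 0" by linarith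
    then show False
    proof cases
      case 1
      then have "e i > point v i"
        using violation_nonneg[OF assms(1)] gain by (simp add: zero_less_mult_iff)
      with 1 best e assms(2) show False by (simp add: point_def)
    next
      case 2
      then have "e i < point v i"
        using violation_nonneg[OF assms(1)] gain by (simp add: mult_less_0_iff)
      with 2 best e assms(2) show False by (simp add: point_def)
    qed
  qed
qed

lemma point_equilibrium_in_E:
  assumes "equilibrium v"
  shows "point v \<in> E"
proof (rule ccontr)
  assume nin: "point v \<notin> E"
  have top: "point v \<in> topspace (Euclidean_space n)"
    by (simp add: topspace_Euclidean_space point_def)
  have e_top: "e \<in> topspace (Euclidean_space n)"
    using e_in B_pos unfolding semialgebraic_def by auto
  have "(\<Sum>b\<in>{1..B}. v (Z a b)) > 0" if a: "a \<in> {1..A}" for a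
  proof -
    obtain b where b: "b \<in> {1..B}" and "\<not> mpoly_eval (P a b) (point v) \<le> 0"
      using nin top a unfolding semialgebraic_def by blast
    then have "gain (Z a b) v > 0"
      using eval_dec_eq[OF dec_equilibrium[OF assms] a b] by simp
    moreover have "Z a b \<in> players" using a b by simp
    ultimately have "v (Z a b) = 1"
      using assms unfolding equilibrium_def by blast
    moreover have "v (Z a b) \<ge> 0" if "b \<in> {1..B}" for b
      using assms a that unfolding equilibrium_def by simp
    ultimately show ?thesis using b by (intro sum_pos2[of _ b]) auto
  qed
  then have "violation v > 0" unfolding violation_def by (intro prod_pos) auto
  \<comment> \<open>Since the violation is positive, a vanishing gain of \<open>X i\<close> can only
    come from the other factor.\<close>
  then have "point v i = e i" if "i < n" for i
    using gain_X_eq_0[OF assms that] dec_equilibrium[OF assms that, of 0] by simp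
  then have "point v i = e i" for i
    using e_top by (cases "i < n") (simp_all add: point_def topspace_Euclidean_space)
  then have "point v = e" ..
  with nin e_in show False by simp
qed

section \<open>From points of \<open>E\<close> to equilibria\<close>

definition profile_at :: "(nat \<Rightarrow> real) \<Rightarrow> player \<Rightarrow> real" where
  "profile_at x p = (if p \<notin> players then 0 else case p of
       X i \<Rightarrow> (x i - c) / r
     | Y i k s \<Rightarrow> 1/2 + x i ^ 2 ^ k / (4 * M ^ 2 ^ k)
     | Z a b \<Rightarrow> of_bool (mpoly_eval (P a b) x > 0))"

lemma point_profile_at:
  assumes "x \<in> E"
  shows "point (profile_at x) = x"
proof -
  have "x \<in> topspace (Euclidean_space n)"
    using assms B_pos unfolding semialgebraic_def by auto
  then show ?thesis
    using r_pos by (auto simp: fun_eq_iff point_def profile_at_def topspace_Euclidean_space)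
qed

text \<open>Exact copies make the \<open>Y\<close> players indifferent, and an \<open>a\<close>
  whose constraints all hold makes the violation vanish, so the \<open>X\<close> players are
  indifferent too. Only \<open>Z\<close> players can have a nonzero gain, and they follow its
  sign.\<close>

lemma equilibrium_profile_at:
  assumes "x \<in> E"
  shows "equilibrium (profile_at x)"
proof -
  let ?v = "profile_at x"
  have dec: "dec i k s ?v = x i ^ 2 ^ k" if "i < n" "k \<le> L" for i k s
    using M_pos that by (simp add: dec_def profile_at_def)
  have target: "target i k ?v = x i ^ 2 ^ k" if "i < n" "k \<le> L" for i k
    using r_pos that by (cases k) (simp_all add: target_def dec profile_at_def add: mult_2 power_add)
  have X01: "0 \<le> ?v (X i) \<and> ?v (X i) \<le> 1" if "i < n" for i
    using box[OF assms that] r_pos by (simp add: profile_at_def field_simps)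
  have Y01: "0 \<le> ?v (Y i k s) \<and> ?v (Y i k s) \<le> 1" if "i < n" for i k s
  proof -
    have "x i = c + r * ?v (X i)" using r_pos that by (simp add: profile_at_def)
    with bound X01[OF that] have "\<bar>x i\<bar> \<le> M" by metis
    then have "\<bar>x i ^ 2 ^ k\<bar> \<le> M ^ 2 ^ k" by (simp add: power_abs power_mono)
    with M_pos have "\<bar>x i ^ 2 ^ k / (4 * M ^ 2 ^ k)\<bar> \<le> 1/4"
      by (simp add: field_simps)
    then show ?thesis unfolding profile_at_def abs_le_iff by simp
  qed
  obtain a where a: "a \<in> {1..A}" and "\<forall>b\<in>{1..B}. mpoly_eval (P a b) x \<le> 0"
    using assms unfolding semialgebraic_def by auto
  then have "(\<Sum>b\<in>{1..B}. ?v (Z a b)) = 0"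
    by (intro sum.neutral) (auto simp: profile_at_def not_less)
  with a have viol: "violation ?v = 0"
    unfolding violation_def by (intro prod_zero) auto
  have gain_Z: "gain (Z a b) ?v = mpoly_eval (P a b) x" if "a \<in> {1..A}" "b \<in> {1..B}" for a b
    using eval_dec_eq[OF dec that] by simp
  have gain_Y: "gain (Y i k s) ?v = 0" if "i < n" "k \<le> L" for i k s
    using that by (cases s) (simp_all add: dec target)
  have "0 \<le> ?v p \<and> ?v p \<le> 1 \<and> (gain p ?v > 0 \<longrightarrow> ?v p = 1) \<and> (gain p ?v < 0 \<longrightarrow> ?v p = 0)"
    if p: "p \<in> players" for p
  proof (cases p)
    case (Z a b)
    with p gain_Z[of a b] show ?thesis by (simp add: profile_at_def del: gain.simps)
  next
    case (X i)
    with p X01[of i] viol show ?thesis by simp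
  next
    case (Y i k s)
    with p Y01[of i k s] gain_Y[of i k s] show ?thesis by (simp del: gain.simps)
  qed
  then show ?thesis by (simp add: equilibrium_def)
qed

section \<open>Numbering the players and transfer to a binary game\<close>

lemma ex_player_numbering:
  defines "N \<equiv> n + 2 * n * Suc L + A * B"
  obtains idx where "bij_betw idx players {..<N}" "\<And>i. i < n \<Longrightarrow> idx (X i) = i"
proof -
  define S where "S = (\<lambda>(i, k, s). Y i k s) ` ({..<n} \<times> {..L} \<times> UNIV)"
  define T where "T = (\<lambda>(a, b). Z a b) ` ({1..A} \<times> {1..B})"
  have "card S = n * (Suc L * 2)"
    unfolding S_def by (subst card_image) (auto simp: inj_on_def card_cartesian_product)
  moreover have "card T = A * B"
    unfolding T_def by (subst card_image) (auto simp: inj_on_def card_cartesian_product)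
  moreover have fin: "finite S" "finite T" by (simp_all add: S_def T_def)
  moreover have "S \<inter> T = {}" by (auto simp: S_def T_def)
  ultimately have "card (S \<union> T) = card {n..<N}"
    by (simp add: card_Un_disjoint N_def)
  then obtain g where g: "bij_betw g (S \<union> T) {n..<N}"
    using finite_same_card_bij[of "S \<union> T" "{n..<N}"] fin by auto
  define idx where "idx p = (case p of X i \<Rightarrow> i | _ \<Rightarrow> g p)" for p
  have "bij_betw idx (X ` {..<n}) {..<n}"
    by (auto simp: bij_betw_def inj_on_def idx_def image_iff)
  moreover have "bij_betw idx (S \<union> T) {n..<N}"
  proof -
    have "bij_betw idx (S \<union> T) {n..<N} \<longleftrightarrow> bij_betw g (S \<union> T) {n..<N}"
      by (rule bij_betw_cong) (auto simp: S_def T_def idx_def)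
    with g show ?thesis by simp
  qed
  ultimately have "bij_betw idx (X ` {..<n} \<union> (S \<union> T)) ({..<n} \<union> {n..<N})"
    by (rule bij_betw_combine) auto
  moreover have "X ` {..<n} \<union> (S \<union> T) = players" by (simp add: players_def S_def T_def Un_assoc)
  moreover have "{..<n} \<union> {n..<N} = {..<N}" by (auto simp: N_def)
  ultimately show ?thesis using that by (simp add: idx_def)
qed

text \<open>Strategies have to be rescaled to give points of \<open>E\<close>; payoffs, being
  decoded copies, show the coordinates directly.\<close>

theorem ex_game:
  defines "N \<equiv> n + 2 * n * Suc L + A * B"
  shows "\<exists>u. (\<lambda>x i. if i < n then c + r * x i else 0) ` nash_equilibria N u = E
    \<and> trunc n ` nash_payoffs N u = E"
proof -
  obtain idx where idx: "bij_betw idx players {..<N}" and idx_X: "\<And>i. i < n \<Longrightarrow> idx (X i) = i"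
    using ex_player_numbering unfolding N_def by metis
  define pl where "pl = the_inv_into players idx"
  have pl: "pl j \<in> players" "idx (pl j) = j" if "j < N" for j
    using idx that unfolding pl_def bij_betw_def
    by (auto intro: the_inv_into_into f_the_inv_into_f)
  have pl_idx: "pl (idx p) = p" "idx p < N" if "p \<in> players" for p
    using idx that unfolding pl_def bij_betw_def by (auto simp: the_inv_into_f_f)
  have pl_X: "pl i = X i" if "i < n" for i
    using pl_idx[of "X i"] idx_X that by simp
  define prof where "prof x p = (if p \<in> players then x (idx p) else 0)" for x :: "nat \<Rightarrow> real" and p
  \<comment> \<open>Changing a numbered strategy changes exactly one named strategy, which transfers
    affinity and independence to \<open>D\<close> and \<open>C\<close>.\<close>
  have prof_upd: "prof (x(j := t)) = (prof x)(pl j := t)" if "j < N" for x j t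
    using pl[OF that] pl_idx by (auto simp: prof_def fun_eq_iff)
  define D where "D j x = gain (pl j) (prof x)" for j x
  define C where "C j x = bonus (pl j) (prof x)" for j x
  have affine: "affine_in j (D i) \<and> affine_in j (C i)" if "i < N" "j < N" for i j
    using gain_affine[of "pl j" "pl i"] bonus_affine[of "pl j" "pl i"]
    unfolding affine_in_def D_def C_def prof_upd[OF that(2)] by blast
  have indep: "indep_of i (D i) \<and> indep_of i (C i)" if "i < N" for i
    using gain_indep[of "pl i"] bonus_indep[of "pl i"]
    unfolding indep_of_def D_def C_def prof_upd[OF that] by blast
  let ?u = "affine_game N D C"
  let ?pt = "\<lambda>x i. if i < n then c + r * x i else 0"
  have pt: "?pt x = point (prof x)" for x
    using idx_X by (auto simp: fun_eq_iff point_def prof_def)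
  have "n \<le> N" by (simp add: N_def)
  have nash_iff: "x \<in> nash_equilibria N ?u \<longleftrightarrow> x \<in> mixed_profiles N \<and>
      (\<forall>i<N. (D i x > 0 \<longrightarrow> x i = 1) \<and> (D i x < 0 \<longrightarrow> x i = 0))" for x
    using affine indep by (rule nash_affine_game_iff)
  have payoff: "expected_payoff N ?u i x = x i * D i x + C i x"
    if "i < N" "x \<in> mixed_profiles N" for i x
    using affine indep that by (rule expected_payoff_affine_game)
  have nash: "equilibrium (prof x)" if "x \<in> nash_equilibria N ?u" for x
    unfolding equilibrium_def
  proof
    fix p assume p: "p \<in> players"
    have j: "idx p < N" and prof: "prof x p = x (idx p)" and D: "D (idx p) x = gain p (prof x)"
      using p pl_idx[OF p] by (simp_all add: prof_def D_def)
    show "0 \<le> prof x p \<and> prof x p \<le> 1 \<and>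
      (gain p (prof x) > 0 \<longrightarrow> prof x p = 1) \<and> (gain p (prof x) < 0 \<longrightarrow> prof x p = 0)"
      using that j unfolding nash_iff mixed_profiles_iff prof D[symmetric] by blast
  qed
  have surj: "\<exists>x\<in>nash_equilibria N ?u. ?pt x = y" if "y \<in> E" for y
  proof -
    let ?v = "profile_at y"
    define x where "x j = (if j < N then ?v (pl j) else 0)" for j
    have prof: "prof x = ?v"
      using pl_idx by (auto simp: fun_eq_iff prof_def x_def profile_at_def)
    have "x \<in> nash_equilibria N ?u"
      unfolding nash_iff mixed_profiles_iff D_def prof
      using equilibrium_profile_at[OF that] pl unfolding equilibrium_def by (simp add: x_def)
    moreover have "?pt x = y"
      using point_profile_at[OF that] unfolding pt prof .
    ultimately show ?thesis by blast
  qed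
  have payoffs: "trunc n (trunc N (\<lambda>i. expected_payoff N ?u i x)) = ?pt x"
    if x: "x \<in> nash_equilibria N ?u" for x
  proof
    fix i
    show "trunc n (trunc N (\<lambda>i. expected_payoff N ?u i x)) i = ?pt x i"
    proof (cases "i < n")
      case True
      have "expected_payoff N ?u i x = x i * D i x + C i x"
        using x True \<open>n \<le> N\<close> by (intro payoff) (auto simp: nash_equilibria_def)
      \<comment> \<open>The gain of \<open>X i\<close> vanishes, so only the bonus remains.\<close>
      also have "\<dots> = point (prof x) i"
        using gain_X_eq_0[OF nash[OF x] True] dec_equilibrium[OF nash[OF x] True, of 0]
        by (simp add: D_def C_def pl_X True del: gain.simps)
      finally show ?thesis using True \<open>n \<le> N\<close> by (simp add: trunc_def pt[symmetric])
    qed (simp add: trunc_def)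
  qed
  have "?pt ` nash_equilibria N ?u = E"
  proof (intro equalityI subsetI)
    fix y assume "y \<in> ?pt ` nash_equilibria N ?u"
    then show "y \<in> E" using point_equilibrium_in_E[OF nash] pt by auto
  next
    fix y assume "y \<in> E"
    from surj[OF this] show "y \<in> ?pt ` nash_equilibria N ?u" by blast
  qed
  moreover have "trunc n ` nash_payoffs N ?u = ?pt ` nash_equilibria N ?u"
    unfolding nash_payoffs_def image_image using payoffs by (intro image_cong) auto
  ultimately show ?thesis by auto
qed

end

section \<open>Bounds from compactness and the choice of scaling\<close>

lemma compactin_Euclidean_space_bounded:
  assumes "compactin (Euclidean_space n) E"
  shows "\<exists>M>0. \<forall>x\<in>E. \<forall>i<n. \<bar>x i\<bar> \<le> M"
proof -
  have "\<exists>b. \<forall>x\<in>E. \<bar>x i\<bar> \<le> b" for i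
  proof -
    have "continuous_map (Euclidean_space n) euclideanreal (\<lambda>x. x i)"
      unfolding Euclidean_space_def
      by (intro continuous_map_from_subtopology continuous_map_product_projection) auto
    with assms have "compact ((\<lambda>x. x i) ` E)"
      using image_compactin by fastforce
    then show ?thesis
      by (auto dest!: compact_imp_bounded simp: bounded_iff)
  qed
  then obtain b where b: "\<And>i x. x \<in> E \<Longrightarrow> \<bar>x i\<bar> \<le> b i" by metis
  have "\<bar>x i\<bar> \<le> 1 + (\<Sum>i<n. \<bar>b i\<bar>)" if "x \<in> E" "i < n" for x i
  proof -
    have "\<bar>b i\<bar> \<le> (\<Sum>i<n. \<bar>b i\<bar>)" using that by (intro member_le_sum) auto
    with b[OF that(1), of i] show ?thesis by linarith
  qed
  moreover have "1 + (\<Sum>i<n. \<bar>b i\<bar>) > 0" by (simp add: add_pos_nonneg sum_nonneg)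
  ultimately show ?thesis by blast
qed

theorem mainTheorem3:
  fixes n A B d :: nat
    and P :: "nat \<Rightarrow> nat \<Rightarrow> real_mpoly"
    and E :: "(nat \<Rightarrow> real) set"
  assumes "n \<ge> 1" and "A \<ge> 1" and "B \<ge> 1" and "d \<ge> 1"
    and "\<And>a b. a \<in> {1..A} \<Longrightarrow> b \<in> {1..B} \<Longrightarrow> mpoly_vars (P a b) \<subseteq> {..<n}"
    and "\<And>a b i. a \<in> {1..A} \<Longrightarrow> b \<in> {1..B} \<Longrightarrow> i < n \<Longrightarrow> mpoly_degree (P a b) i \<le> d"
    and "E = (\<Union>a\<in>{1..A}. \<Inter>b\<in>{1..B}.
               {x \<in> topspace (Euclidean_space n). mpoly_eval (P a b) x \<le> 0})"
    and "E \<noteq> {}" and "compactin (Euclidean_space n) E"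
  shows
    "((\<forall>x\<in>E. \<forall>i<n. x i \<in> {0..1}) \<longrightarrow>
       (\<exists>N>n. real N \<le> 1 + real A * real B + real n * (3 + 2 * log 2 (real d)) \<and>
         (\<exists>u :: binary_game. trunc n ` nash_equilibria N u = E))) \<and>
     (\<exists>N>n. real N \<le> 1 + real A * real B + real n * (3 + 2 * log 2 (real d)) \<and>
         (\<exists>u :: binary_game. trunc n ` nash_payoffs N u = E))"
proof -
  obtain e where e: "e \<in> E" using assms(8) by blast
  have E: "E = semialgebraic n A B P" using assms(7) by (simp add: semialgebraic_def)
  \<comment> \<open>\<open>L\<close> is the integer part of the binary logarithm of
    \<open>d\<close>: large enough for all exponents, and small enough for the count n(3 + 2L) + AB
    of players.\<close>
  obtain L where L: "2 ^ L \<le> d" "d < 2 ^ Suc L"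
    using ex_power_ivl1[of 2 d] assms(4) by auto
  define N where "N = n + 2 * n * Suc L + A * B"
  have "real L \<le> log 2 (real d)"
    using L(1) assms(4) by (simp add: le_log_iff powr_realpow)
  then have "real n * real L \<le> real n * log 2 (real d)" by (simp add: mult_left_mono)
  then have N: "real N \<le> 1 + real A * real B + real n * (3 + 2 * log 2 (real d))"
    by (simp add: N_def algebra_simps)
  have "n < N" using assms(1-3) by (simp add: N_def)
  have game: "\<exists>u. (\<lambda>x i. if i < n then c + r * x i else 0) ` nash_equilibria N u = E
      \<and> trunc n ` nash_payoffs N u = E"
    if "0 < r" "0 < M" "\<And>t. 0 \<le> t \<Longrightarrow> t \<le> 1 \<Longrightarrow> \<bar>c + r * t\<bar> \<le> M"
      "\<And>x i. x \<in> E \<Longrightarrow> i < n \<Longrightarrow> c \<le> x i \<and> x i \<le> c + r" for c r M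
  proof -
    interpret semialgebraic_game n A B d L P e c r M
      by unfold_locales (fact assms(3,5,6) L(2) that e[unfolded E] that(4)[unfolded E])+
    show ?thesis using ex_game by (simp add: N_def E)
  qed
  have "\<exists>u. trunc n ` nash_equilibria N u = E" if "\<forall>x\<in>E. \<forall>i<n. x i \<in> {0..1}"
  proof -
    have "\<exists>u. (\<lambda>x i. if i < n then 0 + 1 * x i else 0) ` nash_equilibria N u = E
      \<and> trunc n ` nash_payoffs N u = E"
      \<comment> \<open>The arguments are \<open>r\<close>, \<open>M\<close>, \<open>c\<close> in
        this order. With offset 0 and length 1, strategies are the coordinates themselves.\<close>
      using that by (intro game[of 1 1 0]) auto
    moreover have "(\<lambda>x i. if i < n then 0 + 1 * x i else 0) = trunc n"
      by (auto simp: trunc_def fun_eq_iff)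
    ultimately show ?thesis by metis
  qed
  moreover have "\<exists>u. trunc n ` nash_payoffs N u = E"
  proof -
    \<comment> \<open>Every coordinate on \<open>E\<close> lies in [-M, M], so the offset is
      \<open>- M\<close> and the length \<open>2 * M\<close>.\<close>
    obtain M where M: "M > 0" "\<And>x i. x \<in> E \<Longrightarrow> i < n \<Longrightarrow> \<bar>x i\<bar> \<le> M"
      using compactin_Euclidean_space_bounded[OF assms(9)] by blast
    have "\<bar>- M + 2 * M * t\<bar> \<le> M" if "0 \<le> t" "t \<le> 1" for t
    proof -
      have "0 \<le> M * t" "M * t \<le> M * 1" using that M(1) by simp_all
      then show ?thesis by (simp add: abs_le_iff)
    qed
    moreover have "- M \<le> x i \<and> x i \<le> - M + 2 * M" if "x \<in> E" "i < n" for x i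
      using M(2)[OF that] by (simp add: abs_le_iff)
    ultimately show ?thesis using M(1) game[of "2 * M" M "- M"] by auto
  qed
  ultimately show ?thesis using N \<open>n < N\<close> by blast
qed

end
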